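(* Let $k\ge 1$ be an integer and let $\ell$ be a prime dividing $2k$. Then for every $\varepsilon\in\{+1,-1\}$, every integer $m\ge 1$ and every $q\in\mathbb{Z}$, $$p_{k,m,\varepsilon,q}\equiv \varepsilon \pmod{\ell},$$ independently of $q$.
   Context: For integers $k,m\ge 1$, $\varepsilon\in\{+1,-1\}$ and $q\in\mathbb{Z}$, put $p_{k,m,\varepsilon,q}:=km(m+1)+\varepsilon+2kq$. (A sign $\varepsilon$ is called admissible if $\gcd(\varepsilon,2k)=1$, which holds for both signs.) *)

theory Defs
  imports "HOL-Number_Theory.Cong"
begin

text \<open>
  The integer \<open>p\<^bsub>k,m,\<epsilon>,q\<^esub>\<close>. It is intended for \<open>k, m \<ge> 1\<close> and \<open>\<epsilon> \<in> {1, -1}\<close>;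
  the formula is total on the integers, so these restrictions have to be hypotheses
  where they are needed.
\<close>

definition p_int :: "int \<Rightarrow> int \<Rightarrow> int \<Rightarrow> int \<Rightarrow> int" where
  "p_int k m \<epsilon> q = k * m * (m + 1) + \<epsilon> + 2 * k * q"

end

theory Submission
  imports Defs
begin

text \<open>
  A product of two consecutive integers is even, so \<open>2 * k\<close> divides \<open>k * m * (m + 1)\<close>
  and not only \<open>2 * k * q\<close>. This is what covers the prime \<open>2\<close> when \<open>k\<close> is odd.
\<close>

lemma p_int_cong_mod_double: "[p_int k m \<epsilon> q = \<epsilon>] (mod 2 * k)"
proof -
  have "2 dvd m * (m + 1)"
    by simp
  then have "2 * k dvd m * (m + 1) * k"
    by (rule mult_dvd_mono) simp
  then have "2 * k dvd m * (m + 1) * k + 2 * k * q"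
    by (rule dvd_add) simp
  also have "m * (m + 1) * k + 2 * k * q = p_int k m \<epsilon> q - \<epsilon>"
    by (simp add: p_int_def algebra_simps)
  finally show ?thesis
    by (simp add: cong_iff_dvd_diff)
qed

theorem theorem1p1:
  fixes k l :: int
  assumes "k \<ge> 1" and "prime l" and "l dvd 2 * k"
  shows "\<forall>\<epsilon>\<in>{1, -1}. \<forall>m\<ge>1. \<forall>q. [p_int k m \<epsilon> q = \<epsilon>] (mod l)"
  using p_int_cong_mod_double assms(3) by (blast intro: cong_dvd_modulus)

end
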